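(* For all positive integers $r,n$, $a_n(FS_r)\ge L(n,r)$, where $$L(n,r)=\sum_{0\le i\le J(n,r)}\binom{p(n-i,r)-1}{i}$$ (the sum being over integers $i$), $p(n,r)=(r-1)n^2+(2r-1)n+r$, and $$J(n,r)=\begin{cases} n/2 & \text{if } r=1,\\[2pt] \left\lfloor (n-1)+\dfrac{(2r-1)-\sqrt{(r-1)n+(2r-1)}}{r-1}\right\rfloor & \text{if } r>1.\end{cases}$$
   Context: $FS_r$ is the free semigroup of rank $r$, i.e. all non-empty words over an alphabet of $r$ letters under concatenation. The (Rees) index of a subsemigroup $T$ of a semigroup $S$ is $|S\setminus T|$, and $a_n(S)$ denotes the number of subsemigroups of $S$ of Rees index exactly $n$. *)

theory Defs
  imports Complex_Main
begin

definition free_semigroup :: "nat \<Rightarrow> nat list set" where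
  "free_semigroup r = lists {..<r} - {[]}"

definition subsemigroup :: "'a set \<Rightarrow> ('a \<Rightarrow> 'a \<Rightarrow> 'a) \<Rightarrow> 'a set \<Rightarrow> bool" where
  "subsemigroup S f T \<longleftrightarrow> T \<subseteq> S \<and> T \<noteq> {} \<and> (\<forall>x\<in>T. \<forall>y\<in>T. f x y \<in> T)"

definition has_rees_index :: "'a set \<Rightarrow> 'a set \<Rightarrow> nat \<Rightarrow> bool" where
  "has_rees_index S T n \<longleftrightarrow> finite (S - T) \<and> card (S - T) = n"

definition num_subsemigroups :: "nat \<Rightarrow> 'a set \<Rightarrow> ('a \<Rightarrow> 'a \<Rightarrow> 'a) \<Rightarrow> nat" where
  "num_subsemigroups n S f = card {T. subsemigroup S f T \<and> has_rees_index S T n}"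

(* The truncated subtractions below are exact for r \<ge> 1. *)
definition p :: "nat \<Rightarrow> nat \<Rightarrow> nat" where
  "p n r = (r - 1) * n\<^sup>2 + (2 * r - 1) * n + r"

definition J :: "nat \<Rightarrow> nat \<Rightarrow> real" where
  "J n r =
     (if r = 1 then real n / 2
      else of_int \<lfloor>(real n - 1)
             + ((2 * real r - 1) - sqrt ((real r - 1) * real n + (2 * real r - 1))) / (real r - 1)\<rfloor>)"

lemma p_pos: "r \<ge> 1 \<Longrightarrow> p n r \<ge> 1"
  by (simp add: p_def)

lemma le_J_imp_le:
  fixes i n r :: nat
  assumes "r \<ge> 1" "n \<ge> 1" "real i \<le> J n r"
  shows "i \<le> n"
proof (cases "r = 1")
  case True
  then show ?thesis using assms by (simp add: J_def)
next
  case False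
  then have r: "real r - 1 > 0" using assms(1) by simp
  define s where "s = sqrt ((real r - 1) * real n + (2 * real r - 1))"
  have "(real r - 1) * real n + (2 * real r - 1) > 1"
    using r assms(2) by (smt (verit) mult_nonneg_nonneg of_nat_0_le_iff)
  then have "s > 1" by (simp add: s_def)
  then have "((2 * real r - 1) - s) / (real r - 1) < 2"
    using r by (simp add: field_simps)
  moreover have "real i \<le> (real n - 1) + ((2 * real r - 1) - s) / (real r - 1)"
    using assms(3) False of_int_floor_le order_trans unfolding J_def s_def by (smt (verit))
  ultimately show ?thesis by linarith
qed

(* By le_J_imp_le and p_pos, neither n - i nor p (n - i) r - 1 is truncated when r, n \<ge> 1. *)
definition L :: "nat \<Rightarrow> nat \<Rightarrow> nat" where
  "L n r = (\<Sum>i\<in>{i. real i \<le> J n r}. (p (n - i) r - 1) choose i)"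

lemma finite_L_indices: "finite {i. real i \<le> J n r}"
proof -
  have "{i. real i \<le> J n r} \<subseteq> {..nat \<lfloor>J n r\<rfloor>}"
    by (auto simp: le_nat_floor)
  then show ?thesis using finite_subset by blast
qed

end

theory Submission
  imports Defs
begin

text \<open>
  Write \<open>a\<close> for the letter \<open>0\<close>. Removing \<open>a, \<dots>, a\<^sup>k\<close> from the free semigroup leaves a
  subsemigroup of index \<open>k\<close> whose irreducible elements are \<open>a\<^sup>j\<close> with \<open>k < j \<le> 2k + 1\<close>
  and \<open>a\<^sup>s x a\<^sup>t\<close> with \<open>s, t \<le> k\<close> and \<open>x \<noteq> a\<close> a letter; there are \<open>p(k, r)\<close> of them.
  Deleting any set of irreducible elements preserves closure. If \<open>a\<^bsup>k+1\<^esup>\<close> is never deleted, then \<open>k\<close>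
  can be recovered as one less than the least exponent of a power of \<open>a\<close> that remains, so deleting
  \<open>i\<close> of the other \<open>p(n - i, r) - 1\<close> irreducible elements for \<open>k = n - i\<close> gives pairwise distinct
  subsemigroups of index \<open>n\<close>. Finally, there are only finitely many subsemigroups of index \<open>n\<close>,
  since each contains all words of length above \<open>2n\<close>.
\<close>

text \<open>Closure of \<open>T\<close> forces every proper cut of \<open>w\<close> to leave its
  prefix or its suffix outside \<open>T\<close>; the cut at \<open>length w\<close> counts
  \<open>w\<close> itself. At most \<open>n\<close> prefixes and \<open>n\<close> suffixes can be
  missing, which bounds the number of cuts.\<close>

lemma has_rees_index_length_le:
  assumes sub: "subsemigroup (free_semigroup r) (@) T"
    and idx: "has_rees_index (free_semigroup r) T n"
    and w: "w \<in> free_semigroup r - T"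
  shows "length w \<le> 2 * n"
proof -
  let ?C = "free_semigroup r - T"
  define P where "P = {j \<in> {1..length w}. take j w \<in> ?C}"
  define Q where "Q = {j \<in> {1..length w}. drop j w \<in> ?C}"
  have fin: "finite ?C" and card: "card ?C = n"
    using idx by (auto simp: has_rees_index_def)
  have "inj_on (\<lambda>j. take j w) P"
    by (rule inj_on_inverseI[where g = length]) (auto simp: P_def)
  then have P: "card P \<le> n"
    using card_inj_on_le[of _ P ?C] fin card by (auto simp: P_def)
  have "inj_on (\<lambda>j. drop j w) Q"
    by (rule inj_on_inverseI[where g = "\<lambda>v. length w - length v"]) (auto simp: Q_def)
  then have Q: "card Q \<le> n"
    using card_inj_on_le[of _ Q ?C] fin card by (auto simp: Q_def)
  have "{1..length w} \<subseteq> P \<union> Q"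
  proof
    fix j assume j: "j \<in> {1..length w}"
    show "j \<in> P \<union> Q"
    proof (cases "j = length w")
      case True
      then show ?thesis using w j by (auto simp: P_def)
    next
      case False
      then have "take j w \<in> free_semigroup r" "drop j w \<in> free_semigroup r"
        using w j by (auto simp: free_semigroup_def dest: in_set_takeD in_set_dropD)
      moreover have "take j w \<notin> T \<or> drop j w \<notin> T"
        using sub w append_take_drop_id[of j w] unfolding subsemigroup_def by (metis (lifting) DiffD2)
      ultimately show ?thesis using j by (auto simp: P_def Q_def)
    qed
  qed
  then have "card {1..length w} \<le> card (P \<union> Q)"
    by (intro card_mono) (auto simp: P_def Q_def)
  also have "\<dots> \<le> card P + card Q"
    by (rule card_Un_le)
  finally show ?thesis using P Q by simp
qed

text \<open>Since \<open>card\<close> of an infinite set is 0, an injection into this family bounds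
  its \<open>card\<close> from below only once the family is known to be finite.\<close>

lemma finite_subsemigroups_of_index:
  "finite {T. subsemigroup (free_semigroup r) (@) T \<and> has_rees_index (free_semigroup r) T n}"
    (is "finite ?M")
proof -
  let ?W = "{w. set w \<subseteq> {..<r} \<and> length w \<le> 2 * n}"
  have "(\<lambda>T. free_semigroup r - T) ` ?M \<subseteq> Pow ?W"
  proof (rule image_subsetI)
    fix T assume "T \<in> ?M"
    then show "free_semigroup r - T \<in> Pow ?W"
      using has_rees_index_length_le[of r T n] by (auto simp: free_semigroup_def)
  qed
  then have "finite ((\<lambda>T. free_semigroup r - T) ` ?M)"
    by (rule finite_subset) (simp add: finite_lists_length_le)
  moreover have "inj_on (\<lambda>T. free_semigroup r - T) ?M"
    by (rule inj_on_inverseI[where g = "\<lambda>C. free_semigroup r - C"])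
      (auto simp: subsemigroup_def)
  ultimately show ?thesis
    by (rule finite_imageD)
qed

definition powers :: "nat set \<Rightarrow> nat list set" where
  "powers I = (\<lambda>j. replicate j 0) ` I"

definition sandwiches :: "nat \<Rightarrow> nat \<Rightarrow> nat list set" where
  "sandwiches r k =
     (\<lambda>(s, x, t). replicate s 0 @ x # replicate t 0) ` ({..k} \<times> {1..<r} \<times> {..k})"

text \<open>The exponents start at \<open>k + 2\<close>: the irreducible power of exponent
  \<open>k + 1\<close> is always kept, as a marker for \<open>k\<close>.\<close>

definition deletable :: "nat \<Rightarrow> nat \<Rightarrow> nat list set" where
  "deletable r k = powers {k + 2..2 * k + 1} \<union> sandwiches r k"

lemma replicate_in_powers_iff: "replicate j 0 \<in> powers I \<longleftrightarrow> j \<in> I"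
  by (auto simp: powers_def)

lemma powers_iff: "w \<in> powers I \<longleftrightarrow> set w \<subseteq> {0} \<and> length w \<in> I"
proof
  assume "set w \<subseteq> {0} \<and> length w \<in> I"
  then have "w = replicate (length w) 0" "length w \<in> I"
    by (auto intro: replicate_eqI)
  then show "w \<in> powers I"
    unfolding powers_def by blast
qed (auto simp: powers_def)

lemma card_powers: "card (powers I) = card I"
  unfolding powers_def by (rule card_image) (auto intro!: inj_onI)

lemma sandwiches_nonzero: "w \<in> sandwiches r k \<Longrightarrow> \<not> set w \<subseteq> {0}"
  by (auto simp: sandwiches_def)

lemma card_sandwiches: "card (sandwiches r k) = (k + 1)\<^sup>2 * (r - 1)"
proof -
  have "inj_on (\<lambda>(s, x, t). replicate s (0::nat) @ x # replicate t 0)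
      ({..k} \<times> {1..<r} \<times> {..k})"
  \<comment> \<open>As \<open>x\<close> is nonzero, the leading zeros end exactly at
    \<open>x\<close>; this recovers \<open>s\<close>, then \<open>x\<close>, then
    \<open>t\<close>.\<close>
  proof (rule inj_on_inverseI[where g = "\<lambda>w. (length (takeWhile (\<lambda>y. y = 0) w),
      hd (dropWhile (\<lambda>y. y = 0) w), length (tl (dropWhile (\<lambda>y. y = 0) w)))"])
    qed (auto simp: takeWhile_append dropWhile_append)
  then show ?thesis
    unfolding sandwiches_def
    by (simp add: card_image card_cartesian_product power2_eq_square ac_simps
        del: mult_Suc mult_Suc_right)
qed

lemma powers_sandwiches_disjoint: "powers I \<inter> sandwiches r k = {}"
  by (meson disjoint_iff powers_iff sandwiches_nonzero)

lemma finite_deletable: "finite (deletable r k)"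
  by (simp add: deletable_def powers_def sandwiches_def)

text \<open>There are \<open>k\<close> powers and \<open>(k + 1)\<^sup>2 * (r - 1)\<close>
  sandwiches; the 1 subtracted from \<open>p k r\<close> stands for the marker.\<close>

lemma card_deletable:
  assumes "r \<ge> 1"
  shows "card (deletable r k) = p k r - 1"
proof -
  obtain q where r: "r = Suc q"
    using assms by (cases r) auto
  have "card (deletable r k) = card (powers {k + 2..2 * k + 1}) + card (sandwiches r k)"
    unfolding deletable_def
    by (rule card_Un_disjoint[OF _ _ powers_sandwiches_disjoint])
      (auto simp: powers_def sandwiches_def)
  then show ?thesis
    by (simp add: card_powers card_sandwiches p_def r power2_eq_square algebra_simps)
qed

text \<open>A power of exponent at most \<open>2 * k + 1\<close> cannot be cut into two words both
  longer than \<open>k\<close>. A cut of a sandwich leaves its nonzero letter in one factor, so the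
  other lies within a block of at most \<open>k\<close> zeros.\<close>

lemma deletable_irreducible:
  assumes "u \<noteq> []" "v \<noteq> []" and uv: "u @ v \<in> deletable r k"
  shows "u \<in> powers {1..k} \<or> v \<in> powers {1..k}"
proof (cases "u @ v \<in> powers {k + 2..2 * k + 1}")
  case True
  then show ?thesis
    using assms(1,2) by (cases u; cases v) (auto simp: powers_iff)
next
  case False
  then obtain s x t where st: "s \<le> k" "t \<le> k"
    and eq: "u @ v = replicate s 0 @ x # replicate t 0"
    using uv by (auto simp: deletable_def sandwiches_def)
  \<comment> \<open>The cut falls either before the nonzero letter \<open>x\<close> or after
    it.\<close>
  consider z where "u @ z = replicate s 0"
    | z where "u = replicate s 0 @ x # z" "replicate t 0 = z @ v"
    using eq by (auto simp: append_eq_append_conv2 Cons_eq_append_conv append_eq_Cons_conv)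
  then show ?thesis
  proof cases
    case (1 z)
    then have "set (u @ z) \<subseteq> {0}" "length (u @ z) = s"
      by (metis set_replicate_conv_if subset_refl empty_subsetI, metis length_replicate)
    then show ?thesis
      using st assms(1) by (cases u) (auto simp: powers_iff)
  next
    case (2 z)
    then have "set (z @ v) \<subseteq> {0}" "length (z @ v) = t"
      by (metis set_replicate_conv_if subset_refl empty_subsetI, metis length_replicate)
    then show ?thesis
      using st assms(2) by (cases v) (auto simp: powers_iff)
  qed
qed

definition pruned :: "nat \<Rightarrow> nat \<Rightarrow> nat list set \<Rightarrow> nat list set" where
  "pruned r k A = free_semigroup r - (powers {1..k} \<union> A)"

lemma powers_subset_free: "r \<ge> 1 \<Longrightarrow> powers {1..k} \<subseteq> free_semigroup r"
  by (auto simp: powers_def free_semigroup_def)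

lemma deletable_subset_free: "r \<ge> 1 \<Longrightarrow> deletable r k \<subseteq> free_semigroup r"
  by (auto simp: deletable_def powers_def sandwiches_def free_semigroup_def)

lemma powers_deletable_disjoint: "powers {1..k} \<inter> deletable r k = {}"
  using powers_sandwiches_disjoint[of "{1..k}" r k]
  by (auto simp: deletable_def powers_iff)

lemma replicate_in_pruned_iff:
  assumes "r \<ge> 1" "A \<subseteq> deletable r k" "j \<le> k + 1"
  shows "replicate j 0 \<in> pruned r k A \<longleftrightarrow> j = k + 1"
proof -
  have "replicate (k + 1) 0 \<notin> sandwiches r k"
    by (metis sandwiches_nonzero set_replicate_Suc subset_refl Suc_eq_plus1)
  then have "replicate (k + 1) 0 \<notin> A"
    using assms(2) replicate_in_powers_iff[of "k + 1" "{k + 2..2 * k + 1}"]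
    by (auto simp del: replicate.simps simp: deletable_def)
  then have "replicate (k + 1) 0 \<in> pruned r k A"
    using assms(1) replicate_in_powers_iff[of "k + 1" "{1..k}"]
    by (auto simp: pruned_def free_semigroup_def)
  moreover have "replicate j 0 \<notin> pruned r k A" if "j \<le> k"
    using that by (cases "j = 0") (auto simp: pruned_def free_semigroup_def replicate_in_powers_iff)
  ultimately show ?thesis
    using assms(3) by (cases "j \<le> k") (auto simp: not_le less_Suc_eq_le dest: le_antisym)
qed

lemma subsemigroup_pruned:
  assumes "r \<ge> 1" "A \<subseteq> deletable r k"
  shows "subsemigroup (free_semigroup r) (@) (pruned r k A)"
  unfolding subsemigroup_def
proof (intro conjI ballI)
  show "pruned r k A \<subseteq> free_semigroup r"
    by (auto simp: pruned_def)
  show "pruned r k A \<noteq> {}"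
    using replicate_in_pruned_iff[OF assms, of "k + 1"] by blast
  fix u v assume u: "u \<in> pruned r k A" and v: "v \<in> pruned r k A"
  then have ne: "u \<noteq> []" "v \<noteq> []"
    and npow: "u \<notin> powers {1..k}" "v \<notin> powers {1..k}"
    by (auto simp: pruned_def free_semigroup_def)
  have "u @ v \<notin> deletable r k"
    using deletable_irreducible[OF ne] npow by blast
  \<comment> \<open>If the product were a power of exponent at most \<open>k\<close>, so would be
    its nonempty factor \<open>u\<close>.\<close>
  moreover have "u @ v \<notin> powers {1..k}"
    using ne npow by (cases u) (auto simp: powers_iff)
  moreover have "u @ v \<in> free_semigroup r"
    using u v by (auto simp: pruned_def free_semigroup_def)
  ultimately show "u @ v \<in> pruned r k A"
    using assms(2) by (auto simp: pruned_def)
qed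

lemma has_rees_index_pruned:
  assumes "r \<ge> 1" "A \<subseteq> deletable r k"
  shows "has_rees_index (free_semigroup r) (pruned r k A) (k + card A)"
proof -
  have eq: "free_semigroup r - pruned r k A = powers {1..k} \<union> A"
    using powers_subset_free[OF assms(1)] deletable_subset_free[OF assms(1)] assms(2)
    by (fastforce simp: pruned_def)
  have fin: "finite A" "finite (powers {1..k})"
    using assms(2) finite_deletable finite_subset by (blast, simp add: powers_def)
  moreover have "card (powers {1..k} \<union> A) = k + card A"
    using assms(2) powers_deletable_disjoint[of k r] fin
    by (subst card_Un_disjoint) (auto simp: card_powers)
  ultimately show ?thesis
    by (simp add: has_rees_index_def eq)
qed

lemma pruned_inject:
  assumes "r \<ge> 1" "A \<subseteq> deletable r k" "B \<subseteq> deletable r l"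
    and eq: "pruned r k A = pruned r l B"
  shows "k = l \<and> A = B"
proof -
  \<comment> \<open>The power of exponent \<open>min k l + 1\<close> lies within the range where
    both markers can be tested: it belongs to the first set iff the minimum is \<open>k\<close>, to
    the second iff it is \<open>l\<close>.\<close>
  have "min k l = k \<longleftrightarrow> min k l = l"
    using replicate_in_pruned_iff[OF assms(1,2), of "min k l + 1"]
      replicate_in_pruned_iff[OF assms(1,3), of "min k l + 1"] eq
    by (simp del: replicate.simps)
  then have "k = l"
    by linarith
  have A: "free_semigroup r - pruned r k A - powers {1..k} = A"
    using assms(2) deletable_subset_free[OF assms(1)] powers_deletable_disjoint[of k r]
    by (fastforce simp: pruned_def)
  have B: "free_semigroup r - pruned r l B - powers {1..l} = B"
    using assms(3) deletable_subset_free[OF assms(1)] powers_deletable_disjoint[of l r]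
    by (fastforce simp: pruned_def)
  show ?thesis
    using A B eq \<open>k = l\<close> by metis
qed

theorem theorem4p2:
  fixes r n :: nat
  assumes "r \<ge> 1" and "n \<ge> 1"
  shows "num_subsemigroups n (free_semigroup r) (@) \<ge> L n r"
proof -
  let ?I = "{i. real i \<le> J n r}"
  let ?D = "SIGMA i:?I. {A. A \<subseteq> deletable r (n - i) \<and> card A = i}"
  let ?f = "\<lambda>(i, A). pruned r (n - i) A"
  let ?M = "{T. subsemigroup (free_semigroup r) (@) T \<and> has_rees_index (free_semigroup r) T n}"
  \<comment> \<open>This keeps \<open>n - i\<close> from truncating, so that the index
    \<open>(n - i) + card A\<close> equals \<open>n\<close>.\<close>
  have le: "i \<le> n" if "i \<in> ?I" for i
    using le_J_imp_le[OF assms] that by simp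
  have "card ?D = (\<Sum>i\<in>?I. card {A. A \<subseteq> deletable r (n - i) \<and> card A = i})"
    by (intro card_SigmaI finite_L_indices ballI)
      (rule finite_subset[of _ "Pow (deletable r (n - _))"], auto simp: finite_deletable)
  then have card: "card ?D = L n r"
    using assms(1) by (simp add: L_def n_subsets finite_deletable card_deletable)
  \<comment> \<open>Equal images force equal deleted sets \<open>A\<close>, and \<open>i\<close> is
    recovered as \<open>card A\<close>.\<close>
  have "inj_on ?f ?D"
    using pruned_inject[OF assms(1)] by (intro inj_onI) (clarsimp, metis)
  moreover have "?f ` ?D \<subseteq> ?M"
  proof (rule image_subsetI)
    fix d assume "d \<in> ?D"
    then obtain i A where "d = (i, A)" "i \<in> ?I" "A \<subseteq> deletable r (n - i)" "card A = i"
      by blast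
    then show "?f d \<in> ?M"
      using subsemigroup_pruned[OF assms(1), of A "n - i"]
        has_rees_index_pruned[OF assms(1), of A "n - i"] le[of i] by simp
  qed
  ultimately have "card ?D \<le> card ?M"
    by (rule card_inj_on_le[OF _ _ finite_subsemigroups_of_index])
  then show ?thesis
    by (simp add: card num_subsemigroups_def)
qed

end
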